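(* Let $G$ be a finite group of order $n$ with identity $e$, and let $S\subseteq G\setminus\{e\}$ satisfy $S=S^{-1}$ and $G=\langle S\rangle$. If $|S|=n-2$, then $\gamma_{S}(\mathrm{Cay}(S:G))=2$.
   Context: $\mathrm{Cay}(S:G)$ is the simple graph with vertex set $G$ in which $a$ and $b$ are adjacent if and only if $ab^{-1}\in S$. For a graph $\Gamma$, $N[v]$ denotes the closed neighborhood of $v$ (the vertex $v$ together with all its neighbors). A signed dominating function of $\Gamma$ is a function $g:V(\Gamma)\to\{-1,1\}$ with $\sum_{u\in N[v]}g(u)>0$ for every $v\in V(\Gamma)$; its weight is $\sum_{v\in V(\Gamma)}g(v)$. The signed domination number $\gamma_{S}(\Gamma)$ is the minimum weight of a signed dominating function of $\Gamma$ (the subscript $S$ in $\gamma_S$ is part of the notation and unrelated to the set $S$). *)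

theory Defs
  imports "HOL-Algebra.Algebra" "Graph_Theory.Graph_Theory"
begin

text \<open>A finite simple graph is a \<^locale>\<open>pair_graph\<close>: an edge between \<open>u\<close> and \<open>v\<close> is
  represented by the two arcs \<open>(u, v)\<close> and \<open>(v, u)\<close>.\<close>

definition Cay :: "'a set \<Rightarrow> ('a, 'b) monoid_scheme \<Rightarrow> 'a pair_pre_digraph" where
  "Cay S G = \<lparr> pverts = carrier G,
     parcs = {(a, b). a \<in> carrier G \<and> b \<in> carrier G \<and> a \<otimes>\<^bsub>G\<^esub> inv\<^bsub>G\<^esub> b \<in> S} \<rparr>"

definition closed_neighborhood :: "'v pair_pre_digraph \<Rightarrow> 'v \<Rightarrow> 'v set" where
  "closed_neighborhood \<Gamma> v = insert v {u. v \<rightarrow>\<^bsub>\<Gamma>\<^esub> u}"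

text \<open>Functions on the vertex set are represented extensionally (\<open>undefined\<close> off the vertices),
  so that there is exactly one HOL function for each function \<open>V(\<Gamma>) \<rightarrow> {-1, 1}\<close>.\<close>

definition signed_dominating_functions :: "'v pair_pre_digraph \<Rightarrow> ('v \<Rightarrow> int) set" where
  "signed_dominating_functions \<Gamma> =
     {g \<in> pverts \<Gamma> \<rightarrow>\<^sub>E {-1, 1}. \<forall>v \<in> pverts \<Gamma>. (\<Sum>u \<in> closed_neighborhood \<Gamma> v. g u) > 0}"

definition weight :: "'v pair_pre_digraph \<Rightarrow> ('v \<Rightarrow> int) \<Rightarrow> int" where
  "weight \<Gamma> g = (\<Sum>v \<in> pverts \<Gamma>. g v)"

definition signed_domination_number :: "'v pair_pre_digraph \<Rightarrow> int" where
  "signed_domination_number \<Gamma> = Min (weight \<Gamma> ` signed_dominating_functions \<Gamma>)"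

text \<open>For a finite simple graph the minimum above is taken over a finite nonempty set,
  since the constant function \<open>1\<close> is a signed dominating function.\<close>

lemma (in pair_graph) signed_dominating_functions_finite_nonempty:
  "finite (signed_dominating_functions G)" "signed_dominating_functions G \<noteq> {}"
proof -
  show "finite (signed_dominating_functions G)"
    unfolding signed_dominating_functions_def
    by (rule finite_subset[OF _ finite_PiE[OF pair_finite_verts, of "\<lambda>_. {-1, 1::int}"]]) auto
  have "(\<lambda>v\<in>pverts G. 1) \<in> signed_dominating_functions G"
  proof -
    have "0 < (\<Sum>u \<in> closed_neighborhood G v. (\<lambda>v\<in>pverts G. 1::int) u)" if v: "v \<in> pverts G" for v
    proof -
      have sub: "closed_neighborhood G v \<subseteq> pverts G"
        using v by (auto simp: closed_neighborhood_def dest: in_arcsD2)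
      then have "finite (closed_neighborhood G v)"
        using pair_finite_verts by (rule finite_subset)
      moreover have "v \<in> closed_neighborhood G v"
        by (simp add: closed_neighborhood_def)
      ultimately have "0 < (\<Sum>u \<in> closed_neighborhood G v. 1::int)"
        by (auto simp: card_gt_0_iff)
      also have "\<dots> = (\<Sum>u \<in> closed_neighborhood G v. (\<lambda>v\<in>pverts G. 1::int) u)"
        using sub by (intro sum.cong) auto
      finally show ?thesis .
    qed
    then show ?thesis
      by (auto simp: signed_dominating_functions_def)
  qed
  then show "signed_dominating_functions G \<noteq> {}" by blast
qed

lemma (in group) pair_graph_Cay:
  assumes "finite (carrier G)" "S \<subseteq> carrier G - {\<one>}" "S = set_inv S"
  shows "pair_graph (Cay S G)"
proof
  show "finite (pverts (Cay S G))" using assms by (simp add: Cay_def)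
  show "finite (parcs (Cay S G))"
    using assms by (auto simp: Cay_def intro: finite_subset[of _ "carrier G \<times> carrier G"])
  show "symmetric (Cay S G)"
  proof -
    have "b \<otimes> inv a \<in> S" if "a \<in> carrier G" "b \<in> carrier G" "a \<otimes> inv b \<in> S" for a b
    proof -
      have "inv (a \<otimes> inv b) \<in> S"
        using that(3) assms(3) by (auto simp: SET_INV_def)
      then show ?thesis using that by (simp add: inv_mult_group)
    qed
    then show ?thesis by (auto simp: symmetric_def sym_def Cay_def)
  qed
qed (use assms in \<open>auto simp: Cay_def\<close>)

end

theory Submission
  imports Defs
begin

text \<open>The complement of \<open>S\<close> is \<open>{\<one>, a}\<close> with \<open>a\<close> an involution, so \<open>n\<close> is even and every closed
  neighborhood omits exactly one vertex, \<open>N[v] = G - {a \<otimes> v}\<close>. The domination condition at \<open>v\<close> thus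
  says that the weight exceeds \<open>g (a \<otimes> v)\<close>. Any \<open>\<plusminus>1\<close>-function of weight 2 satisfies this, whereas
  weight at most 0 would force \<open>g\<close> to be constantly \<open>-1\<close> and its weight to exceed \<open>-1\<close>, hence
  to be 0 rather than \<open>-n\<close>. Weights have the parity of \<open>n\<close>, so 2 is the minimum.\<close>

text \<open>Each value is \<open>2 * of_bool (g v = 1) - 1\<close>. The formula gives both the
  parity of a weight and the weight of an explicit function.\<close>

lemma sum_sign_function:
  fixes g :: "'v \<Rightarrow> int"
  assumes "finite V" "g \<in> V \<rightarrow> {-1, 1}"
  shows "sum g V = 2 * int (card {v \<in> V. g v = 1}) - int (card V)"
proof -
  have "sum g V = (\<Sum>v\<in>V. 2 * of_bool (g v = 1) - 1)"
    using assms(2) by (intro sum.cong) auto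
  also have "\<dots> = 2 * int (card {v \<in> V. g v = 1}) - int (card V)"
    using assms(1) by (simp add: sum_subtractf sum.inter_filter[symmetric] of_bool_def flip: sum_distrib_left)
  finally show ?thesis .
qed

text \<open>The model is a complete graph minus a perfect matching, with \<open>f v\<close> the
  partner of \<open>v\<close>.\<close>

lemma signed_domination_number_cocktail_party:
  assumes fin: "finite (pverts \<Gamma>)" and ne: "pverts \<Gamma> \<noteq> {}" and ev: "even (card (pverts \<Gamma>))"
    and f: "f ` pverts \<Gamma> = pverts \<Gamma>"
    and nbhd: "\<And>v. v \<in> pverts \<Gamma> \<Longrightarrow> closed_neighborhood \<Gamma> v = pverts \<Gamma> - {f v}"
  shows "signed_domination_number \<Gamma> = 2"
proof -
  let ?V = "pverts \<Gamma>"
  have sum_nbhd: "(\<Sum>u\<in>closed_neighborhood \<Gamma> v. g u) = weight \<Gamma> g - g (f v)"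
    if "v \<in> ?V" for v and g :: "'a \<Rightarrow> int"
    using that f fin by (auto simp: nbhd weight_def sum_diff1)
  have sdf_iff: "g \<in> signed_dominating_functions \<Gamma> \<longleftrightarrow>
      g \<in> ?V \<rightarrow>\<^sub>E {-1, 1} \<and> (\<forall>v\<in>?V. g v < weight \<Gamma> g)" for g
  proof -
    \<comment> \<open>Domination at \<open>v\<close> bounds \<open>g (f v)\<close>; as
      \<open>f\<close> is onto, these bounds reach every vertex.\<close>
    have "(\<forall>v\<in>?V. g v < weight \<Gamma> g) \<longleftrightarrow> (\<forall>v\<in>f ` ?V. g v < weight \<Gamma> g)"
      by (simp add: f)
    then show ?thesis
      by (auto simp: signed_dominating_functions_def sum_nbhd)
  qed
  have lower: "2 \<le> weight \<Gamma> g" if g: "g \<in> signed_dominating_functions \<Gamma>" for g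
  proof -
    have range: "g \<in> ?V \<rightarrow> {-1, 1}" and less: "\<And>v. v \<in> ?V \<Longrightarrow> g v < weight \<Gamma> g"
      using g by (auto simp: sdf_iff)
    have "even (weight \<Gamma> g)"
      using ev by (simp add: weight_def sum_sign_function[OF fin range])
    moreover have "0 < weight \<Gamma> g"
    proof (rule ccontr)
      assume w: "\<not> 0 < weight \<Gamma> g"
      have neg: "g v = -1" if "v \<in> ?V" for v
        using less[OF that] w range that by fastforce
      have "weight \<Gamma> g = - int (card ?V)"
        by (simp add: weight_def neg)
      moreover obtain v where "v \<in> ?V"
        using ne by blast
      ultimately show False
        using less[of v] neg[of v] fin ne by (simp add: card_gt_0_iff flip: card_0_eq)
    qed
    ultimately show ?thesis
      by presburger
  qed
  have card_pos: "0 < card ?V"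
    using fin ne by (simp add: card_gt_0_iff)
  \<comment> \<open>A function of weight 2 takes the value 1 exactly once more than half of the
    time. A positive even number of vertices is at least 2, which leaves room for this.\<close>
  then have "card ?V div 2 + 1 \<le> card ?V"
    using ev by presburger
  then obtain P where P: "P \<subseteq> ?V" "card P = card ?V div 2 + 1"
    by (meson obtain_subset_with_card_n)
  define h :: "'a \<Rightarrow> int" where "h = (\<lambda>v\<in>?V. if v \<in> P then 1 else -1)"
  have h_range: "h \<in> ?V \<rightarrow>\<^sub>E {-1, 1}"
    by (auto simp: h_def)
  have "{v \<in> ?V. h v = 1} = P"
    using P(1) by (auto simp: h_def split: if_splits)
  then have "weight \<Gamma> h = 2 * int (card ?V div 2 + 1) - int (card ?V)"
    using sum_sign_function[OF fin, of h] h_range P(2) by (auto simp: weight_def PiE_def)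
  then have weight_h: "weight \<Gamma> h = 2"
    using ev by (auto elim!: evenE)
  moreover have "h v < 2" if "v \<in> ?V" for v
    using that by (simp add: h_def)
  ultimately have "h \<in> signed_dominating_functions \<Gamma>"
    using h_range by (simp add: sdf_iff)
  moreover have "finite (signed_dominating_functions \<Gamma>)"
    unfolding signed_dominating_functions_def
    by (rule finite_subset[OF _ finite_PiE[OF fin, of "\<lambda>_. {-1, 1}"]]) auto
  ultimately show ?thesis
    unfolding signed_domination_number_def using lower weight_h
    by (intro Min_eqI) (auto intro: rev_image_eqI)
qed

text \<open>The elements \<open>\<one>\<close> and \<open>a\<close> missing from the connection set
  exclude \<open>v\<close> and \<open>a \<otimes> v\<close> as neighbors, the latter because
  \<open>a\<close> is its own inverse. Closing the neighborhood restores only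
  \<open>v\<close>.\<close>

lemma (in group) closed_neighborhood_Cay_Diff_involution:
  assumes "a \<in> carrier G" "a \<noteq> \<one>" "a \<otimes> a = \<one>" "v \<in> carrier G"
  shows "closed_neighborhood (Cay (carrier G - {\<one>, a}) G) v = carrier G - {a \<otimes> v}"
proof -
  have "inv a = a"
    using assms by (simp add: inv_equality)
  have "v \<otimes> inv u = \<one> \<longleftrightarrow> u = v" if "u \<in> carrier G" for u
    using that assms(4) by (metis inv_inv inv_closed inv_equality r_inv)
  moreover have "v \<otimes> inv u = a \<longleftrightarrow> u = a \<otimes> v" if "u \<in> carrier G" for u
    using that assms \<open>inv a = a\<close>
    by (metis inv_closed inv_solve_right inv_solve_left)
  moreover have "v \<noteq> a \<otimes> v"
    using assms by simp
  ultimately show ?thesis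
    using assms by (auto simp: closed_neighborhood_def Cay_def)
qed

text \<open>Lagrange's theorem, applied to the element \<open>a\<close> of order 2.\<close>

lemma (in group) even_order_if_involution:
  assumes "finite (carrier G)" "a \<in> carrier G" "a \<noteq> \<one>" "a \<otimes> a = \<one>"
  shows "even (order G)"
proof -
  have "a [^] (2::nat) = \<one>"
    using assms by (simp add: numeral_2_eq_2)
  then have "ord a dvd 2"
    using assms by (simp add: pow_eq_id)
  moreover have "ord a \<noteq> 1"
    using assms ord_eq_1 by blast
  ultimately have "ord a = 2"
    using two_is_prime_nat by (metis prime_nat_iff)
  then show ?thesis
    using ord_dvd_group_order[OF assms(2)] by simp
qed

text \<open>The complement of \<open>S\<close> has two elements, contains \<open>\<one>\<close> and
  is closed under inversion, so its other element is its own inverse. Subtraction over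
  \<open>int\<close> rules out the trivial group, which truncated subtraction would admit with empty
  \<open>S\<close>.\<close>

lemma (in group) symmetric_subset_co_card_2:
  assumes fin: "finite (carrier G)" and S: "S \<subseteq> carrier G - {\<one>}" "S = set_inv S"
    and card: "int (card S) = int (order G) - 2"
  obtains a where "a \<in> carrier G" "a \<noteq> \<one>" "a \<otimes> a = \<one>" "S = carrier G - {\<one>, a}"
proof -
  have "S \<subseteq> carrier G"
    using S(1) by blast
  then have "card S + card (carrier G - S) = order G"
    using fin card_mono[OF fin] by (simp add: order_def card_Diff_subset finite_subset)
  then have "card (carrier G - S) = 2"
    using card by simp
  moreover have one: "\<one> \<in> carrier G - S"
    using S(1) by auto
  ultimately have "card (carrier G - S - {\<one>}) = 1"
    by simp
  then obtain a where "carrier G - S - {\<one>} = {a}"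
    by (rule card_1_singletonE)
  then have a: "a \<noteq> \<one>" "carrier G - S = {\<one>, a}"
    using one by blast+
  then have a_closed: "a \<in> carrier G" "a \<notin> S"
    by auto
  have "inv a \<notin> S"
  proof
    assume "inv a \<in> S"
    then have "inv (inv a) \<in> set_inv S"
      by (auto simp: SET_INV_def)
    then show False
      using a_closed S(2) by simp
  qed
  then have "inv a \<in> {\<one>, a}"
    using a_closed(1) a(2) by (metis DiffI inv_closed)
  then have "inv a = a"
    using a(1) a_closed by auto
  then have "a \<otimes> a = \<one>"
    using a_closed r_inv by fastforce
  moreover have "S = carrier G - {\<one>, a}"
    using a(2) S(1) by blast
  ultimately show thesis
    using that a(1) a_closed by blast
qed

theorem theorem2p4:
  fixes G (structure) and S and n :: nat
  assumes "group G" and "finite (carrier G)" and "order G = n"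
    and "S \<subseteq> carrier G - {\<one>}"
    and "S = set_inv S"
    and "carrier G = generate G S"
    and "int (card S) = int n - 2"
  shows "signed_domination_number (Cay S G) = 2"
proof -
  interpret group G by fact
  obtain a where a: "a \<in> carrier G" "a \<noteq> \<one>" "a \<otimes> a = \<one>" and S: "S = carrier G - {\<one>, a}"
    using symmetric_subset_co_card_2 assms by blast
  have verts: "pverts (Cay T G) = carrier G" for T
    by (simp add: Cay_def)
  \<comment> \<open>Left translation by \<open>a\<close> is the partner map.\<close>
  have "(\<lambda>v. a \<otimes> v) ` carrier G = carrier G"
    using a(1) by (rule surj_const_mult)
  then show ?thesis
    using assms(2) even_order_if_involution[OF assms(2) a] a
    by (intro signed_domination_number_cocktail_party[where f = "\<lambda>v. a \<otimes> v"])
      (auto simp: verts order_def S closed_neighborhood_Cay_Diff_involution)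
qed

end
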